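(* Let $n, b \in \mathbb{N}$ (with $n \ge 1$) be such that $n \le 2^b$, and define $T = \lfloor 2^b/n \rfloor \cdot n$. Sample $r$ uniformly from the integers in $[0, 2^b)$, accept $r$ if and only if $r < T$, and in case of acceptance output $r \bmod n$. Then the output is uniformly distributed over the integers in $[0, n)$; that is, for every integer $j$ with $0 \le j < n$, $$\Pr[\, r \bmod n = j \mid r < T \,] = \frac{1}{n}.$$
   Context: Intervals such as $[0,N)$ denote the set of integers $\{0, 1, \ldots, N-1\}$. The expression $r \bmod n$ denotes the remainder in $\{0,\ldots,n-1\}$ of $r$ upon division by $n$. The distribution of the output is understood conditionally on acceptance (rejected samples produce no output). *)

theory Defs
  imports "HOL-Probability.Probability"
begin

definition threshold :: "nat \<Rightarrow> nat \<Rightarrow> nat" where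
  "threshold n b = nat \<lfloor>(2 ^ b :: real) / real n\<rfloor> * n"

definition sample :: "nat \<Rightarrow> nat pmf" where
  "sample b = pmf_of_set {0..<2 ^ b}"

(* The law of the output given acceptance. cond_pmf is meaningful only if the acceptance
   event has positive probability, which holds for 1 \<le> n \<le> 2 ^ b. *)
definition accepted_output :: "nat \<Rightarrow> nat \<Rightarrow> nat pmf" where
  "accepted_output n b = map_pmf (\<lambda>r. r mod n) (cond_pmf (sample b) {r. r < threshold n b})"

end

theory Submission
  imports Defs
begin

text \<open>The threshold is \<open>q * n\<close> with \<open>q = 2 ^ b div n\<close>, so the
  accepted range consists of \<open>q\<close> complete periods of \<open>mod n\<close>, and each
  residue below \<open>n\<close> is hit exactly \<open>q\<close> times
  (\<open>card_residue_class_lessThan_mult\<close>). Conditioning a uniform law on acceptance leaves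
  it uniform (\<open>cond_pmf_of_set\<close>), so each residue has mass
  \<open>q / (q * n) = 1 / n\<close>. The bounds on \<open>n\<close> give \<open>q > 0\<close>, so
  that acceptance has positive probability.\<close>

lemma threshold_eq: "threshold n b = (2 ^ b div n) * n"
proof -
  have "\<lfloor>(2 ^ b :: real) / real n\<rfloor> = int (2 ^ b div n)"
    using floor_divide_of_nat_eq[of "2 ^ b" n, where ?'a = real] by simp
  then show ?thesis
    by (simp add: threshold_def)
qed

lemma threshold_le: "threshold n b \<le> 2 ^ b"
  by (simp add: threshold_eq)

lemma threshold_pos:
  assumes "n \<ge> 1" and "n \<le> 2 ^ b"
  shows "threshold n b > 0"
  using assms by (simp add: threshold_eq div_greater_zero_iff)

text \<open>Each of the \<open>q\<close> blocks of length \<open>n\<close> contains one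
  representative of \<open>j\<close>: the map \<open>k \<mapsto> k * n + j\<close> is a bijection
  from \<open>{..<q}\<close> onto the class, with inverse
  \<open>r \<mapsto> r div n\<close>.\<close>

lemma card_residue_class_lessThan_mult:
  fixes n j q :: nat
  assumes "j < n"
  shows "card {r. r < q * n \<and> r mod n = j} = q"
proof -
  have "r \<in> (\<lambda>k. k * n + j) ` {..<q}" if "r < q * n" "r mod n = j" for r
  proof (rule image_eqI)
    show "r = (r div n) * n + j"
      using that by (metis div_mult_mod_eq)
    show "r div n \<in> {..<q}"
      using that by (simp add: less_mult_imp_div_less)
  qed
  moreover have "k * n + j < q * n" if "k < q" for k
  proof -
    have "k * n + j < Suc k * n" using assms by simp
    also have "\<dots> \<le> q * n" using that by (intro mult_le_mono1) simp
    finally show ?thesis .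
  qed
  ultimately have "{r. r < q * n \<and> r mod n = j} = (\<lambda>k. k * n + j) ` {..<q}"
    using assms by auto
  moreover have "inj_on (\<lambda>k. k * n + j) {..<q}"
    using assms by (auto intro: inj_onI)
  ultimately show ?thesis
    by (simp add: card_image)
qed

lemma measure_sample:
  assumes "A \<subseteq> {0..<2 ^ b}"
  shows "measure (measure_pmf (sample b)) A = real (card A) / 2 ^ b"
  using assms by (simp add: sample_def measure_pmf_of_set Int_absorb1)

lemma prob_residue_given_accepted:
  fixes n b j :: nat
  assumes "n \<ge> 1" and "n \<le> 2 ^ b" and "j < n"
  shows "\<P>(r in measure_pmf (sample b). r mod n = j \<bar> r < threshold n b) = 1 / real n"
proof -
  let ?T = "threshold n b" and ?q = "2 ^ b div n"
  have "measure (measure_pmf (sample b)) {r. r mod n = j \<and> r < ?T} = real ?q / 2 ^ b"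
  proof -
    have "card {r. r mod n = j \<and> r < ?T} = ?q"
      using card_residue_class_lessThan_mult[OF assms(3), of ?q]
      by (simp add: threshold_eq conj_commute)
    then show ?thesis
      using threshold_le[of n b] by (subst measure_sample) auto
  qed
  moreover have "measure (measure_pmf (sample b)) {r. r < ?T} = real ?T / 2 ^ b"
    using threshold_le[of n b] by (subst measure_sample) auto
  \<comment> \<open>Lets \<open>q\<close> cancel in \<open>(q / 2 ^ b) / (q * n / 2 ^ b)\<close>;
    for \<open>q = 0\<close> the quotient would be \<open>0 / 0 = 0\<close>.\<close>
  moreover have "?q > 0"
    using assms by (simp add: div_greater_zero_iff)
  ultimately show ?thesis
    using assms by (simp add: cond_prob_def threshold_eq)
qed

text \<open>On \<open>A \<inter> B\<close> the mass \<open>1 / card A\<close> is rescaled by the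
  probability \<open>card (A \<inter> B) / card A\<close> of \<open>B\<close>; elsewhere both sides
  vanish.\<close>

lemma cond_pmf_of_set:
  assumes "finite A" and "A \<inter> B \<noteq> {}"
  shows "cond_pmf (pmf_of_set A) B = pmf_of_set (A \<inter> B)"
proof (rule pmf_eqI)
  fix x
  have "A \<noteq> {}"
    using assms by auto
  moreover from this have "set_pmf (pmf_of_set A) \<inter> B \<noteq> {}"
    using assms by simp
  ultimately show "pmf (cond_pmf (pmf_of_set A) B) x = pmf (pmf_of_set (A \<inter> B)) x"
    using assms by (simp add: pmf_cond measure_pmf_of_set indicator_def)
qed

lemma cond_sample:
  assumes "n \<ge> 1" and "n \<le> 2 ^ b"
  shows "cond_pmf (sample b) {r. r < threshold n b} = pmf_of_set {0..<threshold n b}"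
proof -
  have "{0..<2 ^ b} \<inter> {r. r < threshold n b} = {0..<threshold n b}"
    using threshold_le[of n b] by auto
  then show ?thesis
    using threshold_pos[OF assms] unfolding sample_def
    by (subst cond_pmf_of_set) auto
qed

text \<open>The mass at \<open>j\<close> is the size of the fibre of \<open>mod n\<close> over
  \<open>j\<close> within the accepted range, divided by the threshold. Equality of laws also
  requires the points \<open>j \<ge> n\<close>, where both masses are zero.\<close>

lemma accepted_output_uniform:
  assumes "n \<ge> 1" and "n \<le> 2 ^ b"
  shows "accepted_output n b = pmf_of_set {0..<n}"
proof (rule pmf_eqI)
  fix j
  let ?T = "threshold n b"
  have "pmf (accepted_output n b) j = real (card {r. r < ?T \<and> r mod n = j}) / real ?T"
  proof -
    have "{0..<?T} \<inter> (\<lambda>r. r mod n) -` {j} = {r. r < ?T \<and> r mod n = j}"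
      by auto
    then show ?thesis
      using threshold_pos[OF assms]
      by (simp add: accepted_output_def cond_sample[OF assms] pmf_map measure_pmf_of_set)
  qed
  also have "\<dots> = indicator {0..<n} j / real n"
  proof (cases "j < n")
    case True
    then show ?thesis
      using threshold_pos[OF assms] card_residue_class_lessThan_mult[of j n "2 ^ b div n"]
      by (simp add: threshold_eq)
  next
    case False
    \<comment> \<open>Uses \<open>n \<ge> 1\<close>: remainders then stay below \<open>n\<close>,
      whereas \<open>r mod 0 = r\<close>.\<close>
    then have "{r. r < ?T \<and> r mod n = j} = {}"
      using assms by auto
    then show ?thesis
      using False by (simp only: card.empty) simp
  qed
  also have "\<dots> = pmf (pmf_of_set {0..<n}) j"
    using assms by simp
  finally show "pmf (accepted_output n b) j = pmf (pmf_of_set {0..<n}) j" .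
qed

theorem lemma1:
  fixes n b :: nat
  assumes "n \<ge> 1" and "n \<le> 2 ^ b"
  shows "accepted_output n b = pmf_of_set {0..<n} \<and>
    (\<forall>j\<in>{0..<n}.
      \<P>(r in measure_pmf (sample b). r mod n = j \<bar> r < threshold n b) = 1 / real n)"
  using accepted_output_uniform[OF assms] prob_residue_given_accepted[OF assms] by simp

end
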